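(* Let $\mathbf{f}_{T+1}\in\mathbb{R}^S$ be the vector of candidate forecasts at time $T+1$, let $\hat{\mathbf{w}}$ be a (random, data-dependent) weight vector in $\mathbb{R}^S$, let $\hat{y}_{T+1}=\mathbf{f}_{T+1}^\top\hat{\mathbf{w}}$ be the combined forecast, and let $\mu_{T+1}=\mathrm{E}_*(y_{T+1})$. Then the squared conditional bias of the combined forecast satisfies $$\{\mu_{T+1}-\mathrm{E}_*(\hat{y}_{T+1})\}^2\leq \begin{cases} \infty, & \text{if } \hat{\mathbf{w}}\in\mathbb{W}^{\mathcal{A}}\text{ or }\hat{\mathbf{w}}\in\mathbb{W}^{\mathcal{B}},\\ 2\mu_{T+1}^2+2S\,\mathbf{f}_{T+1}^\top\mathbf{f}_{T+1}, & \text{if } \hat{\mathbf{w}}\in\mathbb{W}^{\mathcal{C}},\\ 2\mu_{T+1}^2+2\,\mathbf{f}_{T+1}^\top\mathbf{f}_{T+1}, & \text{if } \hat{\mathbf{w}}\in\mathbb{W}^{\mathcal{D}}\text{ or }\hat{\mathbf{w}}\in\mathbb{W}^{\mathcal{E}}. \end{cases}$$ (The bound $\infty$ means that no finite bound is asserted.)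
   Context: The data are $y_1,\ldots,y_T$, and $y_{T+1}$ is to be forecast by combining $S$ candidate forecasts; $\mathbf{f}_t=(f_{t,1},\ldots,f_{t,S})^\top$ is the vector of candidate forecasts at time $t$. $\mathrm{E}_*(\cdot)=\mathrm{E}(\cdot\mid \mathbf{f}_1,\ldots,\mathbf{f}_{T+1})$ is the conditional expectation given the candidate forecasts, i.e. the candidate forecasts are treated as fixed and the randomness comes solely from the $y_t$; the weight vector $\hat{\mathbf{w}}$ is random through its dependence on $y_1,\ldots,y_T$. Weight spaces, with $\mathbf{1}$ the vector of ones: $\mathbb{W}^{\mathcal{A}}=\mathbb{R}^S$; $\mathbb{W}^{\mathcal{B}}=\{\mathbf{w}\in\mathbb{R}^S:\mathbf{w}^\top\mathbf{1}=1\}$; $\mathbb{W}^{\mathcal{C}}=[0,1]^S$; $\mathbb{W}^{\mathcal{D}}=\{\mathbf{w}\in[0,1]^S:\mathbf{1}^\top\mathbf{w}=1\}$; $\mathbb{W}^{\mathcal{E}}=\{\mathbf{w}\in\mathbb{R}^S:\mathbf{w}^\top\mathbf{w}=1\}$. *)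

theory Defs
  imports "HOL-Probability.Probability"
begin

text \<open>Times are indexed \<open>1, \<dots>, T + 1\<close>. There are \<open>S = CARD('s)\<close> candidate forecasts, so the
  forecast vectors and the weight vectors live in \<^typ>\<open>real ^ 's\<close>.\<close>

definition W_A :: "(real ^ 's::finite) set" where
  "W_A = UNIV"

definition W_B :: "(real ^ 's::finite) set" where
  "W_B = {w. w \<bullet> 1 = 1}"

definition W_C :: "(real ^ 's::finite) set" where
  "W_C = {w. \<forall>i. w $ i \<in> {0..1}}"

definition W_D :: "(real ^ 's::finite) set" where
  "W_D = {w \<in> W_C. 1 \<bullet> w = 1}"

definition W_E :: "(real ^ 's::finite) set" where
  "W_E = {w. w \<bullet> w = 1}"

definition history :: "nat set \<Rightarrow> (nat \<Rightarrow> 'a \<Rightarrow> 'b) \<Rightarrow> 'a \<Rightarrow> (nat \<Rightarrow> 'b)" where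
  "history I X \<omega> = (\<lambda>t\<in>I. X t \<omega>)"

definition forecast_algebra ::
  "'a measure \<Rightarrow> nat \<Rightarrow> (nat \<Rightarrow> 'a \<Rightarrow> real ^ 's::finite) \<Rightarrow> 'a measure" where
  "forecast_algebra M T f =
     vimage_algebra (space M) (history {1..T+1} f) (\<Pi>\<^sub>M t\<in>{1..T+1}. borel)"

text \<open>\<open>E_star M T f X\<close> is a version of the conditional expectation
  \<open>E(X | f\<^sub>1, \<dots>, f\<^bsub>T+1\<^esub>)\<close>. By the definition of \<^const>\<open>real_cond_exp\<close> as the difference of the
  conditional expectations of the positive and the negative part, it is meaningful whenever
  \<open>E(\<bar>X\<bar> | f\<^sub>1, \<dots>, f\<^bsub>T+1\<^esub>)\<close> is finite almost surely, even if \<open>X\<close> is not integrable; the predicate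
  \<open>E_star_exists\<close> expresses this. On a probability space with constant forecasts,
  \<open>E_star_exists\<close> is ordinary integrability and \<open>E_star\<close> is then almost surely the ordinary
  expectation.\<close>

definition E_star ::
  "'a measure \<Rightarrow> nat \<Rightarrow> (nat \<Rightarrow> 'a \<Rightarrow> real ^ 's::finite) \<Rightarrow> ('a \<Rightarrow> real) \<Rightarrow> 'a \<Rightarrow> real" where
  "E_star M T f X = real_cond_exp M (forecast_algebra M T f) X"

definition E_star_exists ::
  "'a measure \<Rightarrow> nat \<Rightarrow> (nat \<Rightarrow> 'a \<Rightarrow> real ^ 's::finite) \<Rightarrow> ('a \<Rightarrow> real) \<Rightarrow> bool" where
  "E_star_exists M T f X \<longleftrightarrow> X \<in> borel_measurable M \<and>
     (AE \<omega> in M. nn_cond_exp M (forecast_algebra M T f) (\<lambda>\<omega>'. ennreal \<bar>X \<omega>'\<bar>) \<omega> < \<infinity>)"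

definition combined_forecast ::
  "nat \<Rightarrow> (nat \<Rightarrow> 'a \<Rightarrow> real ^ 's::finite) \<Rightarrow> ('a \<Rightarrow> real ^ 's) \<Rightarrow> 'a \<Rightarrow> real" where
  "combined_forecast T f w \<omega> = f (T+1) \<omega> \<bullet> w \<omega>"

definition sq_bias ::
  "'a measure \<Rightarrow> nat \<Rightarrow> (nat \<Rightarrow> 'a \<Rightarrow> real) \<Rightarrow> (nat \<Rightarrow> 'a \<Rightarrow> real ^ 's::finite)
     \<Rightarrow> ('a \<Rightarrow> real ^ 's) \<Rightarrow> 'a \<Rightarrow> real" where
  "sq_bias M T y f w \<omega> =
     (E_star M T f (y (T+1)) \<omega> - E_star M T f (combined_forecast T f w) \<omega>)\<^sup>2"

end

theory Submission
  imports Defs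
begin

text \<open>Why the bounds hold. Each bounded weight space lies in a Euclidean ball around the origin:
  \<open>w \<bullet> w \<le> S\<close> on the cube \<^const>\<open>W_C\<close>, and \<open>w \<bullet> w \<le> 1\<close> on the simplex \<^const>\<open>W_D\<close> and the sphere
  \<^const>\<open>W_E\<close>. By Cauchy--Schwarz the combined forecast is then dominated, up to the factor
  \<open>sqrt c\<close> with \<open>c\<close> the bound on \<open>w \<bullet> w\<close>, by the norm of \<open>f\<^bsub>T+1\<^esub>\<close>. That norm is a function of the
  conditioning variables, so it passes unchanged through \<open>E\<^sub>*\<close>, and hence \<open>E\<^sub>*\<close> of the combined
  forecast obeys the same bound almost surely (\<open>E_star_combined_forecast_sq_le\<close>). The inequality
  \<open>(a - b)\<^sup>2 \<le> 2 * a\<^sup>2 + 2 * b\<^sup>2\<close> then separates the two terms of the bias.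

  The norm of \<open>f\<^bsub>T+1\<^esub>\<close> may have infinite expectation. The domination is therefore carried out
  with conditional expectations of nonnegative functions, which always exist in \<open>[0, \<infinity>]\<close>.\<close>

lemma W_C_inner_self_le:
  fixes w :: "real ^ 's::finite"
  assumes "w \<in> W_C"
  shows "w \<bullet> w \<le> real CARD('s)"
proof -
  have "w \<bullet> w = (\<Sum>i\<in>UNIV. w $ i * w $ i)"
    by (simp add: inner_vec_def)
  also have "\<dots> \<le> (\<Sum>i\<in>(UNIV :: 's set). 1)"
    using assms by (intro sum_mono) (simp add: W_C_def mult_le_one)
  finally show ?thesis by simp
qed

text \<open>No number in \<open>[0, 1]\<close> is smaller than its square, so the squares of the weights sum to at most the sum of the
  weights.\<close>

lemma W_D_inner_self_le:
  fixes w :: "real ^ 's::finite"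
  assumes "w \<in> W_D"
  shows "w \<bullet> w \<le> 1"
proof -
  have "w \<bullet> w = (\<Sum>i\<in>UNIV. w $ i * w $ i)"
    by (simp add: inner_vec_def)
  also have "\<dots> \<le> (\<Sum>i\<in>UNIV. w $ i)"
    using assms by (intro sum_mono) (simp add: W_D_def W_C_def mult_left_le)
  also have "\<dots> = 1"
    using assms by (simp add: W_D_def inner_vec_def)
  finally show ?thesis .
qed

text \<open>Pull-out and monotonicity combined: a bound that is already known given \<open>F\<close> survives
  conditioning on \<open>F\<close>. Going through \<^const>\<open>nn_cond_exp\<close> of \<open>\<bar>X\<bar>\<close> covers the case where \<open>h\<close> has
  infinite expectation.\<close>

lemma (in sigma_finite_subalgebra) real_cond_exp_abs_le_F_meas:
  assumes [measurable]: "X \<in> borel_measurable M"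
    and h: "h \<in> borel_measurable F"
    and nonneg: "\<And>\<omega>. 0 \<le> h \<omega>"
    and le: "AE \<omega> in M. \<bar>X \<omega>\<bar> \<le> h \<omega>"
  shows "AE \<omega> in M. \<bar>real_cond_exp M F X \<omega>\<bar> \<le> h \<omega>"
proof -
  have [measurable]: "h \<in> borel_measurable M"
    by (rule measurable_from_subalg[OF subalg h])
  have "AE \<omega> in M. nn_cond_exp M F (\<lambda>\<omega>. ennreal \<bar>X \<omega>\<bar>) \<omega> \<le> nn_cond_exp M F (\<lambda>\<omega>. ennreal (h \<omega>)) \<omega>"
    using le by (intro nn_cond_exp_mono) (auto intro: ennreal_leI)
  moreover have "AE \<omega> in M. ennreal (h \<omega>) = nn_cond_exp M F (\<lambda>\<omega>. ennreal (h \<omega>)) \<omega>"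
    using h by (intro nn_cond_exp_F_meas) simp
  moreover have "AE \<omega> in M. ennreal \<bar>real_cond_exp M F X \<omega>\<bar> \<le> nn_cond_exp M F (\<lambda>\<omega>. ennreal \<bar>X \<omega>\<bar>) \<omega>"
    by (rule real_cond_exp_abs) simp
  ultimately show ?thesis
  proof eventually_elim
    case (elim \<omega>)
    then have "ennreal \<bar>real_cond_exp M F X \<omega>\<bar> \<le> ennreal (h \<omega>)"
      by (metis order_trans)
    then show ?case
      using nonneg by (simp add: ennreal_le_iff)
  qed
qed

lemma measurable_history:
  assumes "\<And>t. t \<in> I \<Longrightarrow> X t \<in> borel_measurable M"
  shows "history I X \<in> M \<rightarrow>\<^sub>M (\<Pi>\<^sub>M t\<in>I. borel)"
  unfolding history_def using assms by (rule measurable_restrict)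

lemma subalgebra_forecast_algebra:
  assumes "\<And>t. t \<in> {1..T+1} \<Longrightarrow> f t \<in> borel_measurable M"
  shows "subalgebra M (forecast_algebra M T f)"
proof -
  have "history {1..T+1} f \<in> M \<rightarrow>\<^sub>M (\<Pi>\<^sub>M t\<in>{1..T+1}. borel)"
    using assms by (rule measurable_history)
  then have "sets (forecast_algebra M T f) \<subseteq> sets M"
    unfolding forecast_algebra_def by (intro sets_image_in_sets) simp_all
  then show ?thesis
    by (simp add: subalgebra_def forecast_algebra_def)
qed

lemma measurable_forecast_algebra:
  assumes "t \<in> {1..T+1}"
  shows "f t \<in> borel_measurable (forecast_algebra M T f)"
proof -
  have "history {1..T+1} f \<in> forecast_algebra M T f \<rightarrow>\<^sub>M (\<Pi>\<^sub>M t\<in>{1..T+1}. borel)"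
    unfolding forecast_algebra_def
    by (rule measurable_vimage_algebra1) (auto simp: history_def space_PiM)
  then have "(\<lambda>\<omega>. history {1..T+1} f \<omega> t) \<in> borel_measurable (forecast_algebra M T f)"
    using assms by (rule measurable_compose[OF _ measurable_component_singleton])
  then show ?thesis
    using assms by (simp add: history_def)
qed

lemma E_star_combined_forecast_sq_le:
  fixes f :: "nat \<Rightarrow> 'a \<Rightarrow> real ^ 's::finite"
  assumes M: "prob_space M"
    and f: "\<And>t. t \<in> {1..T+1} \<Longrightarrow> f t \<in> borel_measurable M"
    and w [measurable]: "w \<in> borel_measurable M"
    and le: "AE \<omega> in M. w \<omega> \<bullet> w \<omega> \<le> c"
  shows "AE \<omega> in M. (E_star M T f (combined_forecast T f w) \<omega>)\<^sup>2 \<le> c * (f (T+1) \<omega> \<bullet> f (T+1) \<omega>)"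
proof -
  interpret prob_space M by (rule M)
  interpret finite_measure_subalgebra M "forecast_algebra M T f"
    by unfold_locales (rule subalgebra_forecast_algebra[OF f])
  have [measurable]: "f (T+1) \<in> borel_measurable M"
    by (rule f) simp
  have [measurable]: "f (T+1) \<in> borel_measurable (forecast_algebra M T f)"
    by (rule measurable_forecast_algebra) simp
  \<comment> \<open>A probability space is not null, so \<open>w \<omega> \<bullet> w \<omega> \<le> c\<close> holds at some \<open>\<omega>\<close>, which forces \<open>c\<close> to be
    nonnegative.\<close>
  have "AE \<omega> in M. 0 \<le> c"
    using le by eventually_elim (metis inner_ge_zero order_trans)
  then have c: "0 \<le> c"
    by simp
  have bound: "AE \<omega> in M. \<bar>combined_forecast T f w \<omega>\<bar> \<le> sqrt c * norm (f (T+1) \<omega>)"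
    using le
  proof eventually_elim
    case (elim \<omega>)
    have "\<bar>combined_forecast T f w \<omega>\<bar> \<le> norm (f (T+1) \<omega>) * norm (w \<omega>)"
      unfolding combined_forecast_def by (rule Cauchy_Schwarz_ineq2)
    also have "\<dots> \<le> norm (f (T+1) \<omega>) * sqrt c"
      using elim by (intro mult_left_mono) (simp_all add: norm_eq_sqrt_inner)
    finally show ?case by (simp add: mult.commute)
  qed
  have "AE \<omega> in M. \<bar>E_star M T f (combined_forecast T f w) \<omega>\<bar> \<le> sqrt c * norm (f (T+1) \<omega>)"
    unfolding E_star_def
  proof (rule real_cond_exp_abs_le_F_meas[OF _ _ _ bound])
    show "combined_forecast T f w \<in> borel_measurable M"
      unfolding combined_forecast_def by measurable
    show "(\<lambda>\<omega>. sqrt c * norm (f (T+1) \<omega>)) \<in> borel_measurable (forecast_algebra M T f)"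
      by measurable
  qed (use c in simp)
  then show ?thesis
  proof eventually_elim
    case (elim \<omega>)
    have "(E_star M T f (combined_forecast T f w) \<omega>)\<^sup>2 \<le> (sqrt c * norm (f (T+1) \<omega>))\<^sup>2"
      using power_mono[OF elim, of 2] by simp
    then show ?case
      using c by (simp add: power_mult_distrib power2_norm_eq_inner)
  qed
qed

lemma sq_bias_le:
  fixes f :: "nat \<Rightarrow> 'a \<Rightarrow> real ^ 's::finite"
  assumes M: "prob_space M"
    and f: "\<And>t. t \<in> {1..T+1} \<Longrightarrow> f t \<in> borel_measurable M"
    and w: "w \<in> borel_measurable M"
    and le: "AE \<omega> in M. w \<omega> \<bullet> w \<omega> \<le> c"
  shows "AE \<omega> in M. sq_bias M T y f w \<omega>
           \<le> 2 * (E_star M T f (y (T+1)) \<omega>)\<^sup>2 + 2 * c * (f (T+1) \<omega> \<bullet> f (T+1) \<omega>)"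
proof -
  have "AE \<omega> in M. (E_star M T f (combined_forecast T f w) \<omega>)\<^sup>2 \<le> c * (f (T+1) \<omega> \<bullet> f (T+1) \<omega>)"
    by (rule E_star_combined_forecast_sq_le[OF M _ w le]) (rule f)
  then show ?thesis
  proof eventually_elim
    case (elim \<omega>)
    have "(a - b)\<^sup>2 \<le> 2 * a\<^sup>2 + 2 * b\<^sup>2" for a b :: real
      using zero_le_power2[of "a + b"] by (simp add: power2_sum power2_diff)
    from this[of "E_star M T f (y (T+1)) \<omega>" "E_star M T f (combined_forecast T f w) \<omega>"] elim
    show ?case
      unfolding sq_bias_def by linarith
  qed
qed

theorem proposition1:
  fixes M :: "'a measure" and T :: nat
    and y :: "nat \<Rightarrow> 'a \<Rightarrow> real"
    and f :: "nat \<Rightarrow> 'a \<Rightarrow> real ^ 's::finite"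
    and g :: "(nat \<Rightarrow> real) \<Rightarrow> (nat \<Rightarrow> real ^ 's) \<Rightarrow> real ^ 's"
    and w :: "'a \<Rightarrow> real ^ 's"
  assumes "prob_space M"
    and "\<And>t. t \<in> {1..T+1} \<Longrightarrow> y t \<in> borel_measurable M"
    and "\<And>t. t \<in> {1..T+1} \<Longrightarrow> f t \<in> borel_measurable M"
    and "E_star_exists M T f (y (T+1))"
    and "(\<lambda>(u, v). g u v) \<in>
           borel_measurable ((\<Pi>\<^sub>M t\<in>{1..T}. borel) \<Otimes>\<^sub>M (\<Pi>\<^sub>M t\<in>{1..T+1}. borel))"
    and "\<And>\<omega>. \<omega> \<in> space M \<Longrightarrow> w \<omega> = g (history {1..T} y \<omega>) (history {1..T+1} f \<omega>)"
  shows
    "((AE \<omega> in M. w \<omega> \<in> W_A) \<or> (AE \<omega> in M. w \<omega> \<in> W_B) \<longrightarrow>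
        (AE \<omega> in M. ereal (sq_bias M T y f w \<omega>) \<le> \<infinity>)) \<and>
     ((AE \<omega> in M. w \<omega> \<in> W_C) \<longrightarrow>
        (AE \<omega> in M. ereal (sq_bias M T y f w \<omega>)
           \<le> ereal (2 * (E_star M T f (y (T+1)) \<omega>)\<^sup>2
                      + 2 * real CARD('s) * (f (T+1) \<omega> \<bullet> f (T+1) \<omega>)))) \<and>
     ((AE \<omega> in M. w \<omega> \<in> W_D) \<or> (AE \<omega> in M. w \<omega> \<in> W_E) \<longrightarrow>
        (AE \<omega> in M. ereal (sq_bias M T y f w \<omega>)
           \<le> ereal (2 * (E_star M T f (y (T+1)) \<omega>)\<^sup>2
                      + 2 * (f (T+1) \<omega> \<bullet> f (T+1) \<omega>))))"
proof -
  note M = assms(1) and y = assms(2) and f = assms(3) and g = assms(5) and w_eq = assms(6)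
  have "(\<lambda>\<omega>. (history {1..T} y \<omega>, history {1..T+1} f \<omega>)) \<in>
      M \<rightarrow>\<^sub>M (\<Pi>\<^sub>M t\<in>{1..T}. borel) \<Otimes>\<^sub>M (\<Pi>\<^sub>M t\<in>{1..T+1}. borel)"
    using y f by (intro measurable_Pair measurable_history) auto
  from measurable_compose[OF this g] have w: "w \<in> borel_measurable M"
    by (simp add: w_eq cong: measurable_cong)
  have bias: "AE \<omega> in M. sq_bias M T y f w \<omega>
      \<le> 2 * (E_star M T f (y (T+1)) \<omega>)\<^sup>2 + 2 * c * (f (T+1) \<omega> \<bullet> f (T+1) \<omega>)"
    if "AE \<omega> in M. w \<omega> \<bullet> w \<omega> \<le> c" for c
    by (rule sq_bias_le[OF M _ w that]) (rule f)
  show ?thesis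
  proof (intro conjI impI)
    assume "AE \<omega> in M. w \<omega> \<in> W_C"
    then have "AE \<omega> in M. w \<omega> \<bullet> w \<omega> \<le> real CARD('s)"
      by eventually_elim (rule W_C_inner_self_le)
    from bias[OF this]
    show "AE \<omega> in M. ereal (sq_bias M T y f w \<omega>)
           \<le> ereal (2 * (E_star M T f (y (T+1)) \<omega>)\<^sup>2
                      + 2 * real CARD('s) * (f (T+1) \<omega> \<bullet> f (T+1) \<omega>))"
      by simp
  next
    assume "(AE \<omega> in M. w \<omega> \<in> W_D) \<or> (AE \<omega> in M. w \<omega> \<in> W_E)"
    then have "AE \<omega> in M. w \<omega> \<bullet> w \<omega> \<le> 1"
      by (auto simp: W_E_def intro: W_D_inner_self_le elim: eventually_mono)
    from bias[OF this]
    show "AE \<omega> in M. ereal (sq_bias M T y f w \<omega>)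
           \<le> ereal (2 * (E_star M T f (y (T+1)) \<omega>)\<^sup>2 + 2 * (f (T+1) \<omega> \<bullet> f (T+1) \<omega>))"
      by simp
  qed simp
qed

end
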